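(* Let $\lambda_1,\lambda_2>0$ and $0<\omega_{\min}\le\omega_{\max}<1$. For any diagonal weight matrices $W_1,W_2\in\mathbb{R}^{2n\times 2n}$ satisfying $\omega_{\min}I\preceq W_i\preceq\omega_{\max}I$, $i=1,2$, one has, for all $x\in\mathbb{R}^{3n}$, $$x^\top A(W_1,W_2)\,x\;\ge\;\|\mathcal{M}x\|_2^2\;\ge\;\sigma_{\min}^2(\mathcal{M})\,\|x\|_2^2,$$ and $$\|A(W_1,W_2)^{-1}\|\le\frac1\alpha,$$ where $A(W_1,W_2)=S^\top S+\lambda_1G^\top W_1G+\lambda_2R^\top W_2R$, $\mathcal{M}=\begin{bmatrix}S\\ \sqrt{\lambda_1\omega_{\min}}\,G\\ \sqrt{\lambda_2\omega_{\min}}\,R\end{bmatrix}$, and $\alpha=\sigma_{\min}^2(\mathcal{M})$.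
   Context: Let $h,w\ge 2$ be integers and $n=hw$. For $m\ge 2$ let $B_m\in\mathbb{R}^{m\times m}$ be the matrix with $(B_m z)_i = z_{i+1}-z_i$ for $1\le i\le m-1$ and $(B_m z)_m = z_m-z_{m-1}$. Put $\nabla_x = I_h\otimes B_w$, $\nabla_y = B_h\otimes I_w$, and $\nabla = \begin{bmatrix}\nabla_x\\ \nabla_y\end{bmatrix}\in\mathbb{R}^{2n\times n}$. Define $S=[\,I_n\;\; -\nabla^\top\,]\in\mathbb{R}^{n\times 3n}$, $G=[\,\nabla\;\; 0_{2n\times 2n}\,]\in\mathbb{R}^{2n\times 3n}$, $R=[\,0_{2n\times n}\;\; I_{2n}\,]\in\mathbb{R}^{2n\times 3n}$. $\sigma_{\min}(\mathcal{M})$ denotes the smallest singular value of $\mathcal{M}$ (which has full column rank, so $\alpha>0$); $\preceq$ is the Loewner order; $\|\cdot\|$ on matrices is the spectral norm. *)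

theory Defs
  imports
    Complex_Main
    "Jordan_Normal_Form.Matrix"
    "Jordan_Normal_Form.Gauss_Jordan_Elimination"
    "Jordan_Normal_Form.Char_Poly"
begin

section \<open>General matrix notions\<close>

definition append_cols :: "'a :: zero mat \<Rightarrow> 'a mat \<Rightarrow> 'a mat" (infixr "@\<^sub>c" 65) where
  "A @\<^sub>c B = four_block_mat A B (0\<^sub>m 0 (dim_col A)) (0\<^sub>m 0 (dim_col B))"

text \<open>The entry of \<open>A \<otimes> B\<close> at row \<open>i\<^sub>1 * dim_row B + i\<^sub>2\<close> and column \<open>j\<^sub>1 * dim_col B + j\<^sub>2\<close> is
  \<open>A(i\<^sub>1,j\<^sub>1) * B(i\<^sub>2,j\<^sub>2)\<close>.\<close>
definition kronecker :: "'a :: times mat \<Rightarrow> 'a mat \<Rightarrow> 'a mat" where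
  "kronecker A B = mat (dim_row A * dim_row B) (dim_col A * dim_col B)
     (\<lambda>(i,j). A $$ (i div dim_row B, j div dim_col B) * B $$ (i mod dim_row B, j mod dim_col B))"

definition vec_norm2 :: "real vec \<Rightarrow> real" where
  "vec_norm2 v = sqrt (v \<bullet> v)"

text \<open>The operator norm induced by the Euclidean norm, in the same form as \<open>onorm\<close>; the term for
  \<open>v = 0\<close> contributes \<open>0 / 0 = 0\<close>.\<close>
definition spectral_norm :: "real mat \<Rightarrow> real" where
  "spectral_norm A =
     (SUP v \<in> carrier_vec (dim_col A). vec_norm2 (A *\<^sub>v v) / vec_norm2 v)"

text \<open>An \<open>m \<times> n\<close> matrix has \<open>min m n\<close> singular values (with multiplicity), so the smaller of the
  two Gram matrices is used; the larger one would add spurious zeros.\<close>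
definition singular_values :: "real mat \<Rightarrow> real set" where
  "singular_values A = {s. 0 \<le> s \<and>
     eigenvalue (if dim_col A \<le> dim_row A then transpose_mat A * A else A * transpose_mat A) (s\<^sup>2)}"

definition min_singular_value :: "real mat \<Rightarrow> real" where
  "min_singular_value A = Min (singular_values A)"

definition loewner_le :: "real mat \<Rightarrow> real mat \<Rightarrow> bool" where
  "loewner_le A B \<longleftrightarrow>
     (\<exists>n. A \<in> carrier_mat n n \<and> B \<in> carrier_mat n n \<and>
        transpose_mat A = A \<and> transpose_mat B = B \<and>
        (\<forall>x \<in> carrier_vec n. 0 \<le> x \<bullet> ((B - A) *\<^sub>v x)))"

section \<open>Discrete gradient\<close>

text \<open>With indices starting at \<open>0\<close>: row \<open>i\<close> is the forward difference at \<open>i\<close>, except that the last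
  row repeats the one before it; see \<open>diff_mat_mult_vec\<close>.\<close>
definition diff_mat :: "nat \<Rightarrow> real mat" where
  "diff_mat m = mat m m (\<lambda>(i,j).
     let k = (if Suc i < m then i else i - 1)
     in if j = Suc k then 1 else if j = k then -1 else 0)"

lemma diff_mat_mult_vec:
  assumes m: "m \<ge> 2" and z: "z \<in> carrier_vec m"
  shows "Suc i < m \<Longrightarrow> (diff_mat m *\<^sub>v z) $ i = z $ Suc i - z $ i"
    and "(diff_mat m *\<^sub>v z) $ (m - 1) = z $ (m - 1) - z $ (m - 2)"
proof -
  have *: "(\<Sum>j = 0..<m. (if j = Suc k then 1 else if j = k then -1 else 0) * z $ j)
      = z $ Suc k - z $ k" if "Suc k < m" for k
  proof -
    have "(\<Sum>j = 0..<m. (if j = Suc k then 1 else if j = k then -1 else 0) * z $ j)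
        = (\<Sum>j = 0..<m. (if j = Suc k then z $ j else 0) - (if j = k then z $ j else 0))"
      by (intro sum.cong) auto
    also have "\<dots> = z $ Suc k - z $ k"
      using that by (simp add: sum_subtractf)
    finally show ?thesis .
  qed
  have row: "(diff_mat m *\<^sub>v z) $ i = (\<Sum>j = 0..<m. (if j = Suc (if Suc i < m then i else i - 1) then 1
      else if j = (if Suc i < m then i else i - 1) then -1 else 0) * z $ j)" if "i < m" for i
    using that z by (simp add: diff_mat_def scalar_prod_def Let_def)
  show "(diff_mat m *\<^sub>v z) $ i = z $ Suc i - z $ i" if "Suc i < m"
    unfolding row[OF Suc_lessD[OF that]] if_P[OF that] by (rule *[OF that])
  have eqs: "m - 1 - 1 = m - 2" "Suc (m - 2) = m - 1" "m - 1 < m" "\<not> Suc (m - 1) < m"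
    using m by auto
  have "Suc (m - 2) < m" using m by linarith
  from *[OF this] show "(diff_mat m *\<^sub>v z) $ (m - 1) = z $ (m - 1) - z $ (m - 2)"
    unfolding row[OF eqs(3)] if_not_P[OF eqs(4)] eqs(1) eqs(2) .
qed

definition grad_x :: "nat \<Rightarrow> nat \<Rightarrow> real mat" where
  "grad_x h w = kronecker (1\<^sub>m h) (diff_mat w)"

definition grad_y :: "nat \<Rightarrow> nat \<Rightarrow> real mat" where
  "grad_y h w = kronecker (diff_mat h) (1\<^sub>m w)"

definition grad :: "nat \<Rightarrow> nat \<Rightarrow> real mat" where
  "grad h w = grad_x h w @\<^sub>r grad_y h w"

section \<open>The block operators\<close>

definition S_mat :: "nat \<Rightarrow> nat \<Rightarrow> real mat" where
  "S_mat h w = 1\<^sub>m (h * w) @\<^sub>c (- transpose_mat (grad h w))"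

definition G_mat :: "nat \<Rightarrow> nat \<Rightarrow> real mat" where
  "G_mat h w = grad h w @\<^sub>c 0\<^sub>m (2 * (h * w)) (2 * (h * w))"

definition R_mat :: "nat \<Rightarrow> nat \<Rightarrow> real mat" where
  "R_mat h w = 0\<^sub>m (2 * (h * w)) (h * w) @\<^sub>c 1\<^sub>m (2 * (h * w))"

definition A_mat :: "nat \<Rightarrow> nat \<Rightarrow> real \<Rightarrow> real \<Rightarrow> real mat \<Rightarrow> real mat \<Rightarrow> real mat" where
  "A_mat h w lam1 lam2 W\<^sub>1 W\<^sub>2 =
     transpose_mat (S_mat h w) * S_mat h w
     + lam1 \<cdot>\<^sub>m (transpose_mat (G_mat h w) * W\<^sub>1 * G_mat h w)
     + lam2 \<cdot>\<^sub>m (transpose_mat (R_mat h w) * W\<^sub>2 * R_mat h w)"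

definition M_mat :: "nat \<Rightarrow> nat \<Rightarrow> real \<Rightarrow> real \<Rightarrow> real \<Rightarrow> real mat" where
  "M_mat h w lam1 lam2 \<omega> =
     S_mat h w
     @\<^sub>r (sqrt (lam1 * \<omega>) \<cdot>\<^sub>m G_mat h w)
     @\<^sub>r (sqrt (lam2 * \<omega>) \<cdot>\<^sub>m R_mat h w)"

lemma block_mat_carrier:
  "grad h w \<in> carrier_mat (2 * (h * w)) (h * w)"
  "S_mat h w \<in> carrier_mat (h * w) (3 * (h * w))"
  "G_mat h w \<in> carrier_mat (2 * (h * w)) (3 * (h * w))"
  "R_mat h w \<in> carrier_mat (2 * (h * w)) (3 * (h * w))"
  "M_mat h w lam1 lam2 \<omega> \<in> carrier_mat (5 * (h * w)) (3 * (h * w))"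
proof -
  show grad: "grad h w \<in> carrier_mat (2 * (h * w)) (h * w)"
    by (rule carrier_matI)
      (simp_all add: grad_def grad_x_def grad_y_def kronecker_def diff_mat_def append_rows_def)
  show S: "S_mat h w \<in> carrier_mat (h * w) (3 * (h * w))"
    using grad by (intro carrier_matI) (simp_all add: S_mat_def append_cols_def)
  show G: "G_mat h w \<in> carrier_mat (2 * (h * w)) (3 * (h * w))"
    using grad by (intro carrier_matI) (simp_all add: G_mat_def append_cols_def)
  show R: "R_mat h w \<in> carrier_mat (2 * (h * w)) (3 * (h * w))"
    by (intro carrier_matI) (simp_all add: R_mat_def append_cols_def)
  show "M_mat h w lam1 lam2 \<omega> \<in> carrier_mat (5 * (h * w)) (3 * (h * w))"
    using S G R by (intro carrier_matI) (simp_all add: M_mat_def append_rows_def)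
qed

end

theory Submission
  imports Defs
begin

text \<open>The Loewner bounds on the weights give \<open>x \<bullet> A x \<ge> \<parallel>M x\<parallel>\<^sup>2\<close> term by term, and \<open>M\<close> is injective
  because its blocks \<open>R\<close> and \<open>S\<close> recover first the last \<open>2n\<close> and then the first \<open>n\<close> components of
  \<open>x\<close>. The bound \<open>\<parallel>M x\<parallel>\<^sup>2 \<ge> \<sigma>\<^sub>m\<^sub>i\<^sub>n\<^sup>2 \<parallel>x\<parallel>\<^sup>2\<close> needs that the infimum of the Rayleigh quotient of a
  symmetric matrix is an eigenvalue; this is obtained without the spectral theorem or compactness.
  Finally, \<open>\<alpha> \<parallel>u\<parallel>\<^sup>2 \<le> u \<bullet> A u\<close> together with \<open>0 \<le> \<parallel>A u - \<alpha> u\<parallel>\<^sup>2\<close> gives \<open>\<alpha> \<parallel>u\<parallel> \<le> \<parallel>A u\<parallel>\<close>.\<close>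

section \<open>Inner products and matrix-vector identities\<close>

lemma scalar_prod_self_nonneg: "0 \<le> x \<bullet> (x :: real vec)"
  by (simp add: scalar_prod_def sum_nonneg)

lemma scalar_prod_self_eq_0:
  fixes x :: "real vec"
  assumes "x \<in> carrier_vec n" and "x \<bullet> x = 0"
  shows "x = 0\<^sub>v n"
proof -
  have "\<forall>i\<in>{0..<n}. x $ i * x $ i = 0"
    using assms by (subst sum_nonneg_eq_0_iff[symmetric]) (auto simp: scalar_prod_def)
  then show ?thesis using assms(1) by (intro eq_vecI) auto
qed

lemma scalar_prod_self_pos:
  fixes x :: "real vec"
  assumes "x \<in> carrier_vec n" and "x \<noteq> 0\<^sub>v n"
  shows "0 < x \<bullet> x"
  using scalar_prod_self_nonneg[of x] scalar_prod_self_eq_0[OF assms(1)] assms(2) by fastforce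

lemma vec_norm2_nonneg: "0 \<le> vec_norm2 v"
  by (simp add: vec_norm2_def scalar_prod_self_nonneg)

lemma vec_norm2_sq: "(vec_norm2 v)\<^sup>2 = v \<bullet> v"
  by (simp add: vec_norm2_def scalar_prod_self_nonneg)

lemma smult_mat_mult_vec:
  fixes A :: "'a :: comm_semiring_0 mat"
  assumes "A \<in> carrier_mat nr nc" and "v \<in> carrier_vec nc"
  shows "(c \<cdot>\<^sub>m A) *\<^sub>v v = c \<cdot>\<^sub>v (A *\<^sub>v v)"
  using assms by (intro eq_vecI) (auto simp: scalar_prod_def sum_distrib_left mult.assoc)

lemma append_cols_mult_vec:
  fixes A :: "'a :: comm_ring_1 mat"
  assumes "A \<in> carrier_mat nr nc1" and "B \<in> carrier_mat nr nc2"
    and "u \<in> carrier_vec nc1" and "v \<in> carrier_vec nc2"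
  shows "(A @\<^sub>c B) *\<^sub>v (u @\<^sub>v v) = A *\<^sub>v u + B *\<^sub>v v"
proof -
  \<comment> \<open>\<open>append_cols\<close> is a four-block matrix whose lower blocks have no
    rows, so they only contribute an appended vector of length 0, which the second step
    drops.\<close>
  have "(A @\<^sub>c B) *\<^sub>v (u @\<^sub>v v)
      = (A *\<^sub>v u + B *\<^sub>v v) @\<^sub>v (0\<^sub>m 0 nc1 *\<^sub>v u + 0\<^sub>m 0 nc2 *\<^sub>v v)"
    using assms unfolding append_cols_def
    by (subst four_block_mat_mult_vec[of _ nr nc1 _ nc2 _ 0]) auto
  also have "\<dots> = A *\<^sub>v u + B *\<^sub>v v"
    using assms by (intro eq_vecI) auto
  finally show ?thesis .
qed

lemma scalar_prod_transpose_mult: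
  fixes B :: "'a :: comm_ring_1 mat"
  assumes "B \<in> carrier_mat m n" and "W \<in> carrier_mat m m" and "x \<in> carrier_vec n"
  shows "x \<bullet> ((transpose_mat B * W * B) *\<^sub>v x) = (B *\<^sub>v x) \<bullet> (W *\<^sub>v (B *\<^sub>v x))"
proof -
  have "(transpose_mat B * W * B) *\<^sub>v x = transpose_mat B *\<^sub>v (W *\<^sub>v (B *\<^sub>v x))"
    using assms by (simp add: assoc_mult_mat_vec[of _ n m _ m] assoc_mult_mat_vec[of _ n m _ n])
  moreover have "x \<bullet> (transpose_mat B *\<^sub>v (W *\<^sub>v (B *\<^sub>v x))) = (transpose_mat B *\<^sub>v (W *\<^sub>v (B *\<^sub>v x))) \<bullet> x"
    using assms by (intro comm_scalar_prod[of _ n]) auto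
  ultimately show ?thesis
    using assms by (simp add: transpose_vec_mult_scalar[OF assms(1,3)] comm_scalar_prod[of _ m])
qed

lemma scalar_prod_gram:
  fixes B :: "'a :: comm_ring_1 mat"
  assumes "B \<in> carrier_mat m n" and "x \<in> carrier_vec n"
  shows "x \<bullet> ((transpose_mat B * B) *\<^sub>v x) = (B *\<^sub>v x) \<bullet> (B *\<^sub>v x)"
  using scalar_prod_transpose_mult[OF assms(1) one_carrier_mat assms(2)] assms by simp

section \<open>Upper and lower bounds on real quadratic forms\<close>

lemma quadratic_form_upper_bound:
  fixes B :: "real mat"
  assumes B: "B \<in> carrier_mat n n"
  obtains C where "C > 0" and "\<And>x. x \<in> carrier_vec n \<Longrightarrow> x \<bullet> (B *\<^sub>v x) \<le> C * (x \<bullet> x)"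
proof -
  define S where "S = (\<Sum>i = 0..<n. \<Sum>j = 0..<n. \<bar>B $$ (i,j)\<bar>)"
  have "0 \<le> S" by (simp add: S_def sum_nonneg)
  \<comment> \<open>Every product of two components of \<open>x\<close> is at most
    \<open>x \<bullet> x\<close> in absolute value, so the sum of the absolute entries is a valid
    constant. Adding 1 makes it positive even for the zero matrix, since its reciprocal serves as a
    step size later.\<close>
  moreover have "x \<bullet> (B *\<^sub>v x) \<le> (S + 1) * (x \<bullet> x)" if x: "x \<in> carrier_vec n" for x
  proof -
    have sq: "x $ i * x $ i \<le> x \<bullet> x" if "i < n" for i
      using that x unfolding scalar_prod_def
      by (intro member_le_sum[where f = "\<lambda>i. x $ i * x $ i"]) auto
    have term_le: "x $ i * (B $$ (i,j) * x $ j) \<le> \<bar>B $$ (i,j)\<bar> * (x \<bullet> x)" if "i < n" "j < n" for i j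
    proof -
      have "2 * \<bar>x $ i * x $ j\<bar> \<le> x $ i * x $ i + x $ j * x $ j"
        using sum_squares_bound[of "\<bar>x $ i\<bar>" "\<bar>x $ j\<bar>"]
        by (simp add: power2_eq_square abs_mult)
      then have le: "\<bar>x $ i * x $ j\<bar> \<le> x \<bullet> x" using sq[OF that(1)] sq[OF that(2)] by linarith
      have "x $ i * (B $$ (i,j) * x $ j) \<le> \<bar>B $$ (i,j)\<bar> * \<bar>x $ i * x $ j\<bar>"
        by (metis abs_ge_self abs_mult mult.left_commute)
      also have "\<dots> \<le> \<bar>B $$ (i,j)\<bar> * (x \<bullet> x)"
        using le by (intro mult_left_mono) auto
      finally show ?thesis .
    qed
    have "x \<bullet> (B *\<^sub>v x) = (\<Sum>i = 0..<n. \<Sum>j = 0..<n. x $ i * (B $$ (i,j) * x $ j))"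
      using x B by (simp add: scalar_prod_def sum_distrib_left)
    also have "\<dots> \<le> (\<Sum>i = 0..<n. \<Sum>j = 0..<n. \<bar>B $$ (i,j)\<bar> * (x \<bullet> x))"
      using term_le by (intro sum_mono) auto
    also have "\<dots> = S * (x \<bullet> x)" by (simp add: S_def sum_distrib_right)
    also have "\<dots> \<le> (S + 1) * (x \<bullet> x)"
      using scalar_prod_self_nonneg[of x] by (intro mult_right_mono) auto
    finally show ?thesis .
  qed
  ultimately show thesis using that[of "S + 1"] by force
qed

lemma obtain_inverse_mat:
  fixes A :: "'a :: field mat"
  assumes A: "A \<in> carrier_mat n n" and "det A \<noteq> 0"
  obtains B where "mat_inverse A = Some B" and "B \<in> carrier_mat n n"
    and "A * B = 1\<^sub>m n" and "B * A = 1\<^sub>m n"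
proof -
  have "A \<in> Units (ring_mat TYPE('a) n ())"
    using assms by (rule det_non_zero_imp_unit)
  then obtain B where B: "mat_inverse A = Some B"
    using mat_inverse(1)[OF A, where b = "()"] by (cases "mat_inverse A") auto
  with mat_inverse(2)[OF A B] that show thesis by blast
qed

text \<open>If \<open>N\<close> is invertible, then testing its quadratic form on \<open>x - t N\<inverse>x\<close> with small \<open>t > 0\<close>
  shows that it is even bounded below by a positive multiple of \<open>\<parallel>x\<parallel>\<^sup>2\<close>.\<close>
lemma psd_invertible_imp_coercive:
  fixes N :: "real mat"
  assumes N: "N \<in> carrier_mat n n" and sym: "transpose_mat N = N" and det: "det N \<noteq> 0"
    and psd: "\<And>x. x \<in> carrier_vec n \<Longrightarrow> 0 \<le> x \<bullet> (N *\<^sub>v x)"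
  obtains c where "c > 0" and "\<And>x. x \<in> carrier_vec n \<Longrightarrow> c * (x \<bullet> x) \<le> x \<bullet> (N *\<^sub>v x)"
proof -
  obtain B where B: "B \<in> carrier_mat n n" and NB: "N * B = 1\<^sub>m n"
    using obtain_inverse_mat[OF N det] by metis
  obtain C where C: "C > 0" and bound: "\<And>x. x \<in> carrier_vec n \<Longrightarrow> x \<bullet> (B *\<^sub>v x) \<le> C * (x \<bullet> x)"
    using quadratic_form_upper_bound[OF B] by blast
  \<comment> \<open>After the inverse is bounded by \<open>C\<close>, the test vector
    \<open>x - t y\<close> yields \<open>x \<bullet> (N *\<^sub>v x) \<ge> (2 t - C t^2) * (x
    \<bullet> x)\<close>. The choice \<open>t = 1 / C\<close> maximizes the factor, and its maximum
    is again \<open>1 / C\<close>.\<close>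
  have "1 / C * (x \<bullet> x) \<le> x \<bullet> (N *\<^sub>v x)" if x: "x \<in> carrier_vec n" for x
  proof -
    define y where "y = B *\<^sub>v x"
    have y: "y \<in> carrier_vec n" using B x by (simp add: y_def)
    have Ny: "N *\<^sub>v y = x"
      unfolding y_def using assoc_mult_mat_vec[OF N B x] NB x by simp
    \<comment> \<open>Symmetry moves \<open>N\<close> onto \<open>y\<close>, where it undoes the
      inverse; this produces the linear term in \<open>t\<close>.\<close>
    have yNx: "y \<bullet> (N *\<^sub>v x) = x \<bullet> x"
      using transpose_vec_mult_scalar[OF N x y] by (simp add: sym Ny)
    have Nx: "N *\<^sub>v x \<in> carrier_vec n" using N x by simp
    have "N *\<^sub>v (x - (1 / C) \<cdot>\<^sub>v y) = N *\<^sub>v x - (1 / C) \<cdot>\<^sub>v x"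
      using N x y by (simp add: mult_minus_distrib_mat_vec[OF N] mult_mat_vec[OF N] Ny)
    then have "0 \<le> (x - (1 / C) \<cdot>\<^sub>v y) \<bullet> (N *\<^sub>v x - (1 / C) \<cdot>\<^sub>v x)"
      using psd[of "x - (1 / C) \<cdot>\<^sub>v y"] x y by simp
    also have "\<dots> = x \<bullet> (N *\<^sub>v x) - 2 / C * (x \<bullet> x) + 1 / C * (1 / C) * (x \<bullet> y)"
      using x y Nx yNx comm_scalar_prod[OF x y]
      by (simp add: minus_scalar_prod_distrib[of _ n] scalar_prod_minus_distrib[of _ n] algebra_simps)
    also have "\<dots> \<le> x \<bullet> (N *\<^sub>v x) - 2 / C * (x \<bullet> x) + 1 / C * (1 / C) * (C * (x \<bullet> x))"
      using bound[OF x] C by (intro add_left_mono mult_left_mono) (auto simp: y_def)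
    also have "\<dots> = x \<bullet> (N *\<^sub>v x) - 1 / C * (x \<bullet> x)"
      using C by (simp add: field_simps)
    finally show ?thesis by simp
  qed
  with C that[of "1 / C"] show thesis by simp
qed

section \<open>The least eigenvalue of a symmetric matrix\<close>

lemma scalar_prod_char_matrix:
  fixes K :: "real mat"
  assumes "K \<in> carrier_mat n n" and "x \<in> carrier_vec n"
  shows "x \<bullet> (char_matrix K e *\<^sub>v x) = x \<bullet> (K *\<^sub>v x) - e * (x \<bullet> x)"
proof -
  have "char_matrix K e *\<^sub>v x = K *\<^sub>v x + (-e) \<cdot>\<^sub>v x"
    using assms unfolding char_matrix_def
    by (simp add: add_mult_distrib_mat_vec[of _ n n] smult_mat_mult_vec[of _ n n])
  then show ?thesis
    using assms by (simp add: scalar_prod_add_distrib[of _ n])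
qed

text \<open>The eigenvalue is the supremum of all lower bounds of the Rayleigh quotient: were it not an
  eigenvalue, \<open>psd_invertible_imp_coercive\<close> would produce a larger lower bound.\<close>
lemma obtain_least_eigenvalue:
  fixes K :: "real mat"
  assumes K: "K \<in> carrier_mat n n" and sym: "transpose_mat K = K" and n: "n > 0"
  obtains e where "eigenvalue K e" and "\<And>x. x \<in> carrier_vec n \<Longrightarrow> e * (x \<bullet> x) \<le> x \<bullet> (K *\<^sub>v x)"
proof -
  define L where "L = {c. \<forall>x\<in>carrier_vec n. c * (x \<bullet> x) \<le> x \<bullet> (K *\<^sub>v x)}"
  \<comment> \<open>An upper bound for the form of \<open>- K\<close> is a lower bound for that of
    \<open>K\<close>, so \<open>L\<close> is nonempty.\<close>
  obtain C where C: "\<And>x. x \<in> carrier_vec n \<Longrightarrow> x \<bullet> ((- K) *\<^sub>v x) \<le> C * (x \<bullet> x)"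
    using quadratic_form_upper_bound[of "- K" n] K by auto
  have "- C * (x \<bullet> x) \<le> x \<bullet> (K *\<^sub>v x)" if x: "x \<in> carrier_vec n" for x
  proof -
    have "(- K) *\<^sub>v x = - (K *\<^sub>v x)" using K x by (intro eq_vecI) auto
    then show ?thesis using C[OF x] K x by simp
  qed
  then have "- C \<in> L" by (simp add: L_def)
  then have L_ne: "L \<noteq> {}" by blast
  \<comment> \<open>A unit vector, available because \<open>n > 0\<close>, has squared length 1, so
    its own form value bounds every member of \<open>L\<close>.\<close>
  have L_bdd: "bdd_above L"
  proof
    fix c assume "c \<in> L"
    then have "c * (unit_vec n 0 \<bullet> unit_vec n 0) \<le> unit_vec n 0 \<bullet> (K *\<^sub>v unit_vec n 0)"
      by (simp add: L_def)
    then show "c \<le> unit_vec n 0 \<bullet> (K *\<^sub>v unit_vec n 0)" using n by simp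
  qed
  define e where "e = Sup L"
  \<comment> \<open>The supremum is itself a lower bound: for each nonzero \<open>x\<close> the
    Rayleigh quotient bounds all of \<open>L\<close> from above.\<close>
  have low: "e * (x \<bullet> x) \<le> x \<bullet> (K *\<^sub>v x)" if x: "x \<in> carrier_vec n" for x
  proof (cases "x = 0\<^sub>v n")
    case False
    then have pos: "0 < x \<bullet> x" using scalar_prod_self_pos[OF x] by blast
    have "e \<le> (x \<bullet> (K *\<^sub>v x)) / (x \<bullet> x)"
      unfolding e_def using L_ne pos x by (intro cSup_least) (auto simp: L_def field_simps)
    then show ?thesis using pos by (simp add: field_simps)
  qed (use K in simp)
  have "eigenvalue K e"
  proof (rule ccontr)
    assume "\<not> eigenvalue K e"
    then have det: "det (char_matrix K e) \<noteq> 0" using eigenvalue_det[OF K] by simp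
    have car: "char_matrix K e \<in> carrier_mat n n" using K by simp
    have tr: "transpose_mat (char_matrix K e) = char_matrix K e"
      unfolding char_matrix_def using K sym by (subst transpose_add[of _ n n]) auto
    have "0 \<le> x \<bullet> (char_matrix K e *\<^sub>v x)" if "x \<in> carrier_vec n" for x
      using low[OF that] scalar_prod_char_matrix[OF K that] by simp
    then obtain c where "c > 0"
      and c: "\<And>x. x \<in> carrier_vec n \<Longrightarrow> c * (x \<bullet> x) \<le> x \<bullet> (char_matrix K e *\<^sub>v x)"
      using psd_invertible_imp_coercive[OF car tr det] by blast
    have "e + c \<in> L"
      using c scalar_prod_char_matrix[OF K] by (auto simp: L_def algebra_simps)
    then have "e + c \<le> e" unfolding e_def using L_bdd by (rule cSup_upper)
    with \<open>c > 0\<close> show False by simp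
  qed
  with low that show thesis by blast
qed

section \<open>The smallest singular value\<close>

lemma eigenvalue_gram:
  fixes M :: "real mat"
  assumes M: "M \<in> carrier_mat m n" and ev: "eigenvalue (transpose_mat M * M) e"
  obtains v where "v \<in> carrier_vec n" and "v \<noteq> 0\<^sub>v n"
    and "(M *\<^sub>v v) \<bullet> (M *\<^sub>v v) = e * (v \<bullet> v)"
proof -
  obtain v where v: "v \<in> carrier_vec n" "v \<noteq> 0\<^sub>v n"
    and "(transpose_mat M * M) *\<^sub>v v = e \<cdot>\<^sub>v v"
    using ev M by (auto simp: eigenvalue_def eigenvector_def)
  \<comment> \<open>Pairing the eigenvector equation with \<open>v\<close> turns its left side into
    the squared length of \<open>M *\<^sub>v v\<close>.\<close>
  then have "(M *\<^sub>v v) \<bullet> (M *\<^sub>v v) = e * (v \<bullet> v)"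
    using scalar_prod_gram[OF M v(1)] by simp
  with v that show thesis by blast
qed

text \<open>\<open>Min\<close> is meaningful only on a finite nonempty set. Finiteness comes from
  the roots of the characteristic polynomial of the Gram matrix. The root of its least eigenvalue
  \<open>e\<close> is a member, so the minimum squared is at most \<open>e\<close>, which bounds the
  Rayleigh quotient from below.\<close>

lemma min_singular_value:
  fixes M :: "real mat"
  assumes M: "M \<in> carrier_mat m n" and n: "0 < n" and le: "n \<le> m"
  shows min_singular_value_in: "min_singular_value M \<in> singular_values M"
    and min_singular_value_bound:
      "x \<in> carrier_vec n \<Longrightarrow> (min_singular_value M)\<^sup>2 * (x \<bullet> x) \<le> (M *\<^sub>v x) \<bullet> (M *\<^sub>v x)"
proof -
  define K where "K = transpose_mat M * M"
  have K: "K \<in> carrier_mat n n" using M by (simp add: K_def)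
  have sym: "transpose_mat K = K"
    unfolding K_def using M by (subst transpose_mult[of _ n m _ n]) auto
  \<comment> \<open>The assumption \<open>n \<le> m\<close> selects the Gram matrix
    \<open>transpose_mat M * M\<close> in the definition.\<close>
  have sv: "singular_values M = {s. 0 \<le> s \<and> eigenvalue K (s\<^sup>2)}"
    using M le by (simp add: singular_values_def K_def)
  obtain e where ev: "eigenvalue K e"
    and low: "\<And>x. x \<in> carrier_vec n \<Longrightarrow> e * (x \<bullet> x) \<le> x \<bullet> (K *\<^sub>v x)"
    using obtain_least_eigenvalue[OF K sym n] by blast
  have "0 \<le> e"
  proof -
    obtain v where v: "v \<in> carrier_vec n" "v \<noteq> 0\<^sub>v n"
      and eq: "(M *\<^sub>v v) \<bullet> (M *\<^sub>v v) = e * (v \<bullet> v)"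
      using eigenvalue_gram[OF M] ev unfolding K_def by blast
    then have "0 \<le> e * (v \<bullet> v)" using scalar_prod_self_nonneg[of "M *\<^sub>v v"] by simp
    then show ?thesis using scalar_prod_self_pos[OF v] by (simp add: zero_le_mult_iff)
  qed
  have fin: "finite (singular_values M)"
  proof -
    have "char_poly K \<noteq> 0" using degree_monic_char_poly[OF K] by auto
    then have "finite {r. poly (char_poly K) r = 0}" by (rule poly_roots_finite)
    then have "finite {r. eigenvalue K r}" by (simp add: eigenvalue_root_char_poly[OF K])
    then have "finite (sqrt ` {r. eigenvalue K r})" by simp
    \<comment> \<open>A nonnegative \<open>s\<close> is recovered from the eigenvalue as
      \<open>sqrt (s^2)\<close>.\<close>
    moreover have "singular_values M \<subseteq> sqrt ` {r. eigenvalue K r}"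
      unfolding sv by (force simp: image_iff)
    ultimately show ?thesis by (rule rev_finite_subset)
  qed
  have mem: "sqrt e \<in> singular_values M" using ev \<open>0 \<le> e\<close> by (simp add: sv)
  then show min_in: "min_singular_value M \<in> singular_values M"
    unfolding min_singular_value_def using fin by (intro Min_in) auto
  have "min_singular_value M \<le> sqrt e"
    unfolding min_singular_value_def using fin mem by (rule Min_le)
  then have "(min_singular_value M)\<^sup>2 \<le> e"
    using min_in \<open>0 \<le> e\<close> by (simp add: sv sqrt_ge_absD)
  then show "(min_singular_value M)\<^sup>2 * (x \<bullet> x) \<le> (M *\<^sub>v x) \<bullet> (M *\<^sub>v x)" if x: "x \<in> carrier_vec n"
    using low[OF x] scalar_prod_gram[OF M x] mult_right_mono[OF _ scalar_prod_self_nonneg[of x]]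
    unfolding K_def by fastforce
qed

text \<open>The minimum is attained, so if it were 0, the matching eigenvector of the Gram matrix
  would be a nonzero kernel vector of \<open>M\<close>.\<close>

lemma min_singular_value_pos:
  fixes M :: "real mat"
  assumes M: "M \<in> carrier_mat m n" and n: "0 < n" and le: "n \<le> m"
    and inj: "\<And>x. x \<in> carrier_vec n \<Longrightarrow> M *\<^sub>v x = 0\<^sub>v m \<Longrightarrow> x = 0\<^sub>v n"
  shows "0 < min_singular_value M"
proof -
  have in_sv: "0 \<le> min_singular_value M" "eigenvalue (transpose_mat M * M) ((min_singular_value M)\<^sup>2)"
    using min_singular_value_in[OF M n le] M le by (auto simp: singular_values_def)
  obtain v where v: "v \<in> carrier_vec n" "v \<noteq> 0\<^sub>v n"
    and eq: "(M *\<^sub>v v) \<bullet> (M *\<^sub>v v) = (min_singular_value M)\<^sup>2 * (v \<bullet> v)"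
    using eigenvalue_gram[OF M in_sv(2)] by blast
  have Mv: "M *\<^sub>v v \<in> carrier_vec m" using M v by simp
  then have "M *\<^sub>v v \<noteq> 0\<^sub>v m" using inj v by blast
  then have "min_singular_value M \<noteq> 0" using scalar_prod_self_pos[OF Mv] eq by auto
  with in_sv(1) show ?thesis by simp
qed

section \<open>The inverse of a coercive matrix\<close>

lemma coercive_inverse:
  fixes A :: "real mat"
  assumes A: "A \<in> carrier_mat n n" and \<alpha>: "\<alpha> > 0"
    and low: "\<And>x. x \<in> carrier_vec n \<Longrightarrow> \<alpha> * (x \<bullet> x) \<le> x \<bullet> (A *\<^sub>v x)"
  shows coercive_imp_invertible: "invertible_mat A"
    and coercive_imp_inverse_norm: "spectral_norm (the (mat_inverse A)) \<le> 1 / \<alpha>"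
proof -
  \<comment> \<open>On a kernel vector the quadratic form vanishes, while coercivity makes it
    positive unless the vector is 0.\<close>
  have "det A \<noteq> 0"
  proof
    assume "det A = 0"
    then obtain v where v: "v \<in> carrier_vec n" "v \<noteq> 0\<^sub>v n" and "A *\<^sub>v v = 0\<^sub>v n"
      using det_0_iff_vec_prod_zero[OF A] by blast
    then have "\<alpha> * (v \<bullet> v) \<le> 0" using low[OF v(1)] by simp
    then show False using scalar_prod_self_pos[OF v] \<alpha> by (simp add: mult_le_0_iff)
  qed
  then obtain B where inv: "mat_inverse A = Some B" and B: "B \<in> carrier_mat n n"
    and AB: "A * B = 1\<^sub>m n" and BA: "B * A = 1\<^sub>m n"
    using obtain_inverse_mat[OF A] by metis
  show "invertible_mat A"
    using A B AB BA by (auto simp: invertible_mat_def inverts_mat_def)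
  have "vec_norm2 (B *\<^sub>v v) / vec_norm2 v \<le> 1 / \<alpha>" if v: "v \<in> carrier_vec n" for v
  proof -
    define u where "u = B *\<^sub>v v"
    have u: "u \<in> carrier_vec n" using B v by (simp add: u_def)
    have Au: "A *\<^sub>v u = v"
      unfolding u_def using assoc_mult_mat_vec[OF A B v] AB v by simp
    have "0 \<le> (v - \<alpha> \<cdot>\<^sub>v u) \<bullet> (v - \<alpha> \<cdot>\<^sub>v u)" by (rule scalar_prod_self_nonneg)
    also have "\<dots> = v \<bullet> v - 2 * \<alpha> * (u \<bullet> v) + \<alpha> * \<alpha> * (u \<bullet> u)"
      using u v comm_scalar_prod[OF u v]
      by (simp add: minus_scalar_prod_distrib[of _ n] scalar_prod_minus_distrib[of _ n] algebra_simps)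
    \<comment> \<open>Coercivity at \<open>u\<close> reads
      \<open>\<alpha> * (u \<bullet> u) \<le> u \<bullet> v\<close>. Multiplied by
      \<open>2 * \<alpha>\<close>, it absorbs the mixed term and flips the sign of the last
      one.\<close>
    also have "\<dots> \<le> v \<bullet> v - \<alpha> * \<alpha> * (u \<bullet> u)"
      using mult_left_mono[OF low[OF u, unfolded Au], of "2 * \<alpha>"] \<alpha> by (simp add: algebra_simps)
    finally have "(\<alpha> * vec_norm2 u)\<^sup>2 \<le> (vec_norm2 v)\<^sup>2"
      by (simp add: power_mult_distrib vec_norm2_sq power2_eq_square[of \<alpha>])
    then have "\<alpha> * vec_norm2 u \<le> vec_norm2 v"
      using vec_norm2_nonneg by (rule power2_le_imp_le)
    \<comment> \<open>If \<open>v\<close> has norm 0, the quotient is 0 by the convention for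
      division by 0.\<close>
    then show ?thesis
      using \<alpha> vec_norm2_nonneg[of v] unfolding u_def[symmetric]
      by (cases "vec_norm2 v = 0") (auto simp: field_simps)
  qed
  \<comment> \<open>A uniform bound passes to the supremum only over a nonempty index set.\<close>
  moreover have "carrier_vec n \<noteq> ({} :: real vec set)" using zero_carrier_vec by blast
  ultimately show "spectral_norm (the (mat_inverse A)) \<le> 1 / \<alpha>"
    unfolding inv spectral_norm_def option.sel using B by (intro cSUP_least) auto
qed

section \<open>The weights, the stacked operator \<open>M_mat\<close> and the form of
  \<open>A_mat\<close>\<close>

lemma loewner_le_smult_one:
  fixes W :: "real mat"
  assumes "loewner_le (c \<cdot>\<^sub>m 1\<^sub>m n) W" and W: "W \<in> carrier_mat n n" and y: "y \<in> carrier_vec n"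
  shows "c * (y \<bullet> y) \<le> y \<bullet> (W *\<^sub>v y)"
proof -
  have "0 \<le> y \<bullet> ((W - c \<cdot>\<^sub>m 1\<^sub>m n) *\<^sub>v y)"
    using assms by (auto simp: loewner_le_def)
  also have "(W - c \<cdot>\<^sub>m 1\<^sub>m n) *\<^sub>v y = W *\<^sub>v y - c \<cdot>\<^sub>v y"
    using W y by (simp add: minus_mult_distrib_mat_vec[of _ n n] smult_mat_mult_vec[of _ n n])
  finally show ?thesis
    using W y by (simp add: scalar_prod_minus_distrib[of _ n])
qed

lemma M_mat_mult_vec:
  assumes "x \<in> carrier_vec (3 * (h * w))"
  shows "M_mat h w lam1 lam2 \<omega> *\<^sub>v x
    = S_mat h w *\<^sub>v x @\<^sub>v sqrt (lam1 * \<omega>) \<cdot>\<^sub>v (G_mat h w *\<^sub>v x)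
        @\<^sub>v sqrt (lam2 * \<omega>) \<cdot>\<^sub>v (R_mat h w *\<^sub>v x)"
proof -
  note S = block_mat_carrier(2)[of h w] and G = block_mat_carrier(3)[of h w]
    and R = block_mat_carrier(4)[of h w]
  note cG = smult_carrier_mat[OF G, of "sqrt (lam1 * \<omega>)"]
    and cR = smult_carrier_mat[OF R, of "sqrt (lam2 * \<omega>)"]
  show ?thesis
    unfolding M_mat_def mat_mult_append[OF S carrier_append_rows[OF cG cR] assms]
      mat_mult_append[OF cG cR assms] smult_mat_mult_vec[OF G assms] smult_mat_mult_vec[OF R assms] ..
qed

text \<open>Stacked blocks contribute their squared lengths separately, and the square roots in
  \<open>M_mat\<close> become plain weights. The result has the same three terms as
  \<open>A_mat_quadratic_form\<close>, with \<open>\<omega>\<close> in place of the weight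
  matrices.\<close>

lemma M_mat_norm:
  assumes x: "x \<in> carrier_vec (3 * (h * w))" and "0 \<le> lam1 * \<omega>" and "0 \<le> lam2 * \<omega>"
  shows "(M_mat h w lam1 lam2 \<omega> *\<^sub>v x) \<bullet> (M_mat h w lam1 lam2 \<omega> *\<^sub>v x)
    = (S_mat h w *\<^sub>v x) \<bullet> (S_mat h w *\<^sub>v x)
      + lam1 * \<omega> * ((G_mat h w *\<^sub>v x) \<bullet> (G_mat h w *\<^sub>v x))
      + lam2 * \<omega> * ((R_mat h w *\<^sub>v x) \<bullet> (R_mat h w *\<^sub>v x))"
proof -
  let ?n = "h * w"
  define s g r where "s = S_mat h w *\<^sub>v x" and "g = G_mat h w *\<^sub>v x" and "r = R_mat h w *\<^sub>v x"
  let ?g = "sqrt (lam1 * \<omega>) \<cdot>\<^sub>v g" and ?r = "sqrt (lam2 * \<omega>) \<cdot>\<^sub>v r"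
  have s: "s \<in> carrier_vec ?n" and g: "?g \<in> carrier_vec (2 * ?n)" and r: "?r \<in> carrier_vec (2 * ?n)"
    using block_mat_carrier(2-4)[of h w] x by (auto simp: s_def g_def r_def)
  have gr: "?g @\<^sub>v ?r \<in> carrier_vec (2 * ?n + 2 * ?n)" using g r by (rule append_carrier_vec)
  have sq: "(sqrt c \<cdot>\<^sub>v v) \<bullet> (sqrt c \<cdot>\<^sub>v v) = c * (v \<bullet> v)" if "0 \<le> c" for c v
    using that by (simp flip: mult.assoc)
  show ?thesis
    unfolding M_mat_mult_vec[OF x] s_def[symmetric] g_def[symmetric] r_def[symmetric]
      scalar_prod_append[OF s gr s gr] scalar_prod_append[OF g r g r] sq[OF assms(2)] sq[OF assms(3)]
    by (rule add.assoc[symmetric])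
qed

lemma M_mat_inj:
  assumes pos: "0 < lam2 * \<omega>" and x: "x \<in> carrier_vec (3 * (h * w))"
    and Mx: "M_mat h w lam1 lam2 \<omega> *\<^sub>v x = 0\<^sub>v (5 * (h * w))"
  shows "x = 0\<^sub>v (3 * (h * w))"
proof -
  let ?n = "h * w"
  note carrier = block_mat_carrier[of h w]
  define s g r where "s = S_mat h w *\<^sub>v x" and "g = G_mat h w *\<^sub>v x" and "r = R_mat h w *\<^sub>v x"
  have s: "s \<in> carrier_vec ?n" and g: "g \<in> carrier_vec (2 * ?n)" and r: "r \<in> carrier_vec (2 * ?n)"
    using carrier x by (auto simp: s_def g_def r_def)
  \<comment> \<open>The block heights add up as \<open>5 n = n + 2 n + 2 n\<close>; this splitting
    allows a comparison block by block.\<close>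
  have zero: "0\<^sub>v (5 * ?n) = 0\<^sub>v ?n @\<^sub>v 0\<^sub>v (2 * ?n) @\<^sub>v (0\<^sub>v (2 * ?n) :: real vec)"
    by (intro eq_vecI) auto
  have "s @\<^sub>v sqrt (lam1 * \<omega>) \<cdot>\<^sub>v g @\<^sub>v sqrt (lam2 * \<omega>) \<cdot>\<^sub>v r = 0\<^sub>v ?n @\<^sub>v 0\<^sub>v (2 * ?n) @\<^sub>v 0\<^sub>v (2 * ?n)"
    using Mx unfolding M_mat_mult_vec[OF x] zero s_def g_def r_def .
  then have s0: "s = 0\<^sub>v ?n" and r_eq: "sqrt (lam2 * \<omega>) \<cdot>\<^sub>v r = 0\<^sub>v (2 * ?n)"
    using s g r by (auto simp: append_vec_eq[of _ ?n] append_vec_eq[of _ "2 * ?n"])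
  \<comment> \<open>Pairing with \<open>r\<close> gives a scalar equation, from which the positive
    factor cancels.\<close>
  have "r \<bullet> r = 0"
  proof -
    have "sqrt (lam2 * \<omega>) * (r \<bullet> r) = 0"
      using arg_cong[OF r_eq, of "\<lambda>v. r \<bullet> v"] r by simp
    then show ?thesis using pos by auto
  qed
  then have r0: "r = 0\<^sub>v (2 * ?n)" using scalar_prod_self_eq_0[OF r] by blast
  define u p where "u = vec_first x ?n" and "p = vec_last x (2 * ?n)"
  have u: "u \<in> carrier_vec ?n" and p: "p \<in> carrier_vec (2 * ?n)" by (simp_all add: u_def p_def)
  have x_eq: "x = u @\<^sub>v p"
    unfolding u_def p_def using x by (subst vec_first_last_append) auto
  have "r = p"
    unfolding r_def x_eq R_mat_def using u p
    by (subst append_cols_mult_vec[of _ "2 * ?n" ?n _ "2 * ?n"]) auto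
  with r0 have p0: "p = 0\<^sub>v (2 * ?n)" by simp
  \<comment> \<open>Once \<open>p\<close> is known to vanish, the gradient block of
    \<open>S_mat\<close> contributes nothing and its identity block returns
    \<open>u\<close>.\<close>
  have "s = u"
    unfolding s_def x_eq S_mat_def using u p carrier(1)
    by (subst append_cols_mult_vec[of _ ?n ?n _ "2 * ?n"]) (auto simp: p0)
  with s0 have "u = 0\<^sub>v ?n" by simp
  with p0 show ?thesis unfolding x_eq by (intro eq_vecI) auto
qed

lemma A_mat_quadratic_form:
  assumes x: "x \<in> carrier_vec (3 * (h * w))"
    and W: "W\<^sub>1 \<in> carrier_mat (2 * (h * w)) (2 * (h * w))" "W\<^sub>2 \<in> carrier_mat (2 * (h * w)) (2 * (h * w))"
  shows "x \<bullet> (A_mat h w lam1 lam2 W\<^sub>1 W\<^sub>2 *\<^sub>v x)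
    = (S_mat h w *\<^sub>v x) \<bullet> (S_mat h w *\<^sub>v x)
      + lam1 * ((G_mat h w *\<^sub>v x) \<bullet> (W\<^sub>1 *\<^sub>v (G_mat h w *\<^sub>v x)))
      + lam2 * ((R_mat h w *\<^sub>v x) \<bullet> (W\<^sub>2 *\<^sub>v (R_mat h w *\<^sub>v x)))"
proof -
  let ?N = "3 * (h * w)"
  note S = block_mat_carrier(2)[of h w] and G = block_mat_carrier(3)[of h w]
    and R = block_mat_carrier(4)[of h w]
  define P Q T where "P = transpose_mat (S_mat h w) * S_mat h w"
    and "Q = transpose_mat (G_mat h w) * W\<^sub>1 * G_mat h w"
    and "T = transpose_mat (R_mat h w) * W\<^sub>2 * R_mat h w"
  have car: "P \<in> carrier_mat ?N ?N" "Q \<in> carrier_mat ?N ?N" "T \<in> carrier_mat ?N ?N"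
    using S G R W unfolding P_def Q_def T_def by (auto intro!: mult_carrier_mat)
  have "A_mat h w lam1 lam2 W\<^sub>1 W\<^sub>2 *\<^sub>v x = P *\<^sub>v x + lam1 \<cdot>\<^sub>v (Q *\<^sub>v x) + lam2 \<cdot>\<^sub>v (T *\<^sub>v x)"
    unfolding A_mat_def P_def[symmetric] Q_def[symmetric] T_def[symmetric] using car x
    by (simp add: add_mult_distrib_mat_vec[of _ ?N ?N] smult_mat_mult_vec[of _ ?N ?N] del: assoc_add_mat)
  then have "x \<bullet> (A_mat h w lam1 lam2 W\<^sub>1 W\<^sub>2 *\<^sub>v x)
      = x \<bullet> (P *\<^sub>v x) + lam1 * (x \<bullet> (Q *\<^sub>v x)) + lam2 * (x \<bullet> (T *\<^sub>v x))"
    using car x by (simp add: scalar_prod_add_distrib[of _ ?N])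
  then show ?thesis
    unfolding P_def Q_def T_def
      scalar_prod_gram[OF S x] scalar_prod_transpose_mult[OF G W(1) x]
      scalar_prod_transpose_mult[OF R W(2) x] .
qed

theorem lemma6p2:
  fixes h w n :: nat
    and lam1 lam2 \<omega>min \<omega>max \<alpha> :: real
    and W\<^sub>1 W\<^sub>2 A M :: "real mat"
  assumes "h \<ge> 2" and "w \<ge> 2" and n_def: "n = h * w"
    and "lam1 > 0" and "lam2 > 0"
    and "0 < \<omega>min" and "\<omega>min \<le> \<omega>max" and "\<omega>max < 1"
    and "W\<^sub>1 \<in> carrier_mat (2 * n) (2 * n)" and "diagonal_mat W\<^sub>1"
    and "W\<^sub>2 \<in> carrier_mat (2 * n) (2 * n)" and "diagonal_mat W\<^sub>2"
    and "loewner_le (\<omega>min \<cdot>\<^sub>m 1\<^sub>m (2 * n)) W\<^sub>1" and "loewner_le W\<^sub>1 (\<omega>max \<cdot>\<^sub>m 1\<^sub>m (2 * n))"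
    and "loewner_le (\<omega>min \<cdot>\<^sub>m 1\<^sub>m (2 * n)) W\<^sub>2" and "loewner_le W\<^sub>2 (\<omega>max \<cdot>\<^sub>m 1\<^sub>m (2 * n))"
    and A_def: "A = A_mat h w lam1 lam2 W\<^sub>1 W\<^sub>2"
    and M_def: "M = M_mat h w lam1 lam2 \<omega>min"
    and \<alpha>_def: "\<alpha> = (min_singular_value M)\<^sup>2"
  shows "(\<forall>x \<in> carrier_vec (3 * n).
            x \<bullet> (A *\<^sub>v x) \<ge> (vec_norm2 (M *\<^sub>v x))\<^sup>2 \<and>
            (vec_norm2 (M *\<^sub>v x))\<^sup>2 \<ge> (min_singular_value M)\<^sup>2 * (vec_norm2 x)\<^sup>2) \<and>
         \<alpha> > 0 \<and>
         invertible_mat A \<and>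
         spectral_norm (the (mat_inverse A)) \<le> 1 / \<alpha>"
proof -
  have M: "M \<in> carrier_mat (5 * n) (3 * n)"
    unfolding M_def n_def by (rule block_mat_carrier)
  have A: "A \<in> carrier_mat (3 * n) (3 * n)"
    using assms(9,11) block_mat_carrier(2-4)[of h w]
    unfolding A_def A_mat_def n_def by (auto intro!: mult_carrier_mat)
  have n_pos: "0 < 3 * n" and dims: "3 * n \<le> 5 * n" using assms(1,2) by (auto simp: n_def)
  have AM: "(M *\<^sub>v x) \<bullet> (M *\<^sub>v x) \<le> x \<bullet> (A *\<^sub>v x)" if x: "x \<in> carrier_vec (3 * n)" for x
  proof -
    define g r where "g = G_mat h w *\<^sub>v x" and "r = R_mat h w *\<^sub>v x"
    have g: "g \<in> carrier_vec (2 * n)" and r: "r \<in> carrier_vec (2 * n)"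
      using x block_mat_carrier(3,4)[of h w] by (auto simp: n_def g_def r_def)
    have W1: "lam1 * (\<omega>min * (g \<bullet> g)) \<le> lam1 * (g \<bullet> (W\<^sub>1 *\<^sub>v g))"
      using loewner_le_smult_one[OF assms(13,9) g] \<open>lam1 > 0\<close> by simp
    have W2: "lam2 * (\<omega>min * (r \<bullet> r)) \<le> lam2 * (r \<bullet> (W\<^sub>2 *\<^sub>v r))"
      using loewner_le_smult_one[OF assms(15,11) r] \<open>lam2 > 0\<close> by simp
    \<comment> \<open>The \<open>S_mat\<close> terms on both sides coincide, so the sum of the two
      weighted estimates is the whole claim.\<close>
    show ?thesis
      using add_mono[OF W1 W2] M_mat_norm[of x h w lam1 \<omega>min lam2] x assms(4-6)
        A_mat_quadratic_form[OF x[unfolded n_def] assms(9,11)[unfolded n_def], of lam1 lam2]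
      by (simp add: M_def A_def n_def g_def r_def mult.assoc)
  qed
  have M_low: "\<alpha> * (x \<bullet> x) \<le> (M *\<^sub>v x) \<bullet> (M *\<^sub>v x)" if "x \<in> carrier_vec (3 * n)" for x
    unfolding \<alpha>_def using min_singular_value_bound[OF M n_pos dims that] .
  have "0 < min_singular_value M"
    using M_mat_inj[of lam2 \<omega>min _ h w lam1] assms(5,6)
    by (intro min_singular_value_pos[OF M n_pos dims]) (simp add: M_def n_def)
  then have \<alpha>_pos: "0 < \<alpha>" by (simp add: \<alpha>_def)
  have A_low: "\<alpha> * (x \<bullet> x) \<le> x \<bullet> (A *\<^sub>v x)" if "x \<in> carrier_vec (3 * n)" for x
    using AM[OF that] M_low[OF that] by simp
  show ?thesis
    using AM M_low \<alpha>_pos coercive_imp_invertible[OF A \<alpha>_pos A_low]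
      coercive_imp_inverse_norm[OF A \<alpha>_pos A_low]
    by (simp add: vec_norm2_sq \<alpha>_def)
qed

end
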